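(* Let $(K,v)$ be a henselian valued field and let $F\in K[x]$ be a monic, irreducible, defectless polynomial of degree $n>1$. Let $r$ be the Okutsu depth of $F$, and let $\mu_F$ be the inductive valuation attached to $F$. Let $m_i$ (degrees of the key polynomials), $\gamma_i$ (slopes) and $\lambda_i$ (secondary slopes), $0\le i\le r$, be the data of any optimal MacLane chain of $\mu_F$. Then the weight of $F$ satisfies $$ w(F)=\frac{\gamma_r}{m_r}=\frac{\lambda_0}{m_0}+\cdots+\frac{\lambda_r}{m_r}. $$
   Context: $(K,v)$ is a henselian valued field; $v$ also denotes its unique extension to a fixed algebraic closure $\overline{K}$. $\Gamma=v(K^* )$ and $\mathbb{Q}\Gamma=\Gamma\otimes\mathbb{Q}$ is the value group of $v$ on $\overline K$; $v(0)=\infty$. Defectless: a monic irreducible $F\in K[x]$ with root $\theta\in\overline K$ is defectless if $\deg(F)=e(K(\theta)/K)\,f(K(\theta)/K)$ (ramification index times residue degree). Weight: for $F$ monic irreducible of degree $n>1$ with root $\theta$, let $W(\theta)=\{v(g(\theta))/\deg(g)\mid g\in K[x]\text{ monic},\ 0<\deg(g)<n\}$. If $W(\theta)$ has a maximum, $w(F)=w(\theta)=\max W(\theta)$. A pair $\phi,F$ is a distinguished pair of polynomials if $\phi\in K[x]$ is a monic polynomial of minimal degree such that $v(\phi(\theta))/\deg(\phi)=w(F)$. Okutsu frames: an Okutsu frame of $F$ is a list $[\phi_0,\dots,\phi_r]$ of monic irreducible polynomials in $K[x]$ with $\deg(\phi_0)=1$ and such that $\phi_i,\phi_{i+1}$ is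 a distinguished pair for all $0\le i\le r$, where $\phi_{r+1}=F$. Then $r$ is the Okutsu depth of $F$. It is known that $F$ is defectless if and only if it admits an Okutsu frame. Key polynomials: for a valuation $\mu$ on $K(x)$ extending $v$, with value group $\Gamma_\mu$, put $\mathcal P_\alpha=\{g\in K[x]\mid\mu(g)\ge\alpha\}$, $\mathcal P_\alpha^+=\{g\in K[x]\mid\mu(g)>\alpha\}$, and $\mathcal G_\mu=\bigoplus_{\alpha\in\Gamma_\mu}\mathcal P_\alpha/\mathcal P_\alpha^+$ (an integral domain). Let $H_\mu(g)=g+\mathcal P_{\mu(g)}^+$ for $g\neq0$ and $H_\mu(0)=0$. A key polynomial for $\mu$ is a monic $\phi\in K[x]$ such that $H_\mu(\phi)$ is a prime element of $\mathcal G_\mu$ and $H_\mu(\phi)\nmid H_\mu(f)$ for all nonzero $f\in K[x]$ with $\deg(f)<\deg(\phi)$. Augmentation: if $\phi$ is a key polynomial for $\mu$ and $\gamma>\mu(\phi)$, then $[\mu;\phi,\gamma]$ is the valuation sending $f=\sum_{s\ge0}a_s\phi^s$ (with $\deg(a_s)<\deg(\phi)$) to $\min_s\{\mu(a_s)+s\gamma\}$. Inductive valuations: $\mu$ is inductive if $\mu=\mu_r$ for a chain $\mu_0,\dots,\mu_r$ where $\mu_0\big(\sum_s a_s\phi_0^s\big)=\min_s\{v(a_s)+s\gamma_0\}$ for some monic $\phi_0\in K[x]$ of degree one ($a_s\in K$), and $\mu_i=[\mu_{i-1};\phi_i,\gamma_i]$ for $0<i\le r$, with $\gamma_0,\dots,\gamma_r\in\mathbb{Q}\Gamma$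 and $\phi_i$ a key polynomial for $\mu_{i-1}$. With $m_i=\deg(\phi_i)$, the chain is an optimal MacLane chain of $\mu$ if $1=m_0\mid\cdots\mid m_r$ and $m_0<\cdots<m_r$. The slopes satisfy $\gamma_i=\mu_i(\phi_i)=\mu(\phi_i)$; the secondary slopes are $\lambda_0=\gamma_0$ and $\lambda_i=\mu_i(\phi_i)-\mu_{i-1}(\phi_i)$ for $0<i\le r$. The length $r$ and the data $m_i,\gamma_i,\lambda_i$ are known to depend only on $\mu$. Attached valuation: for $F$ defectless of degree $>1$ with root $\theta$ and Okutsu frame $[\phi_0,\dots,\phi_r]$, the inductive valuation attached to $F$ is $\mu_F\big(\sum_s a_s\phi_r^s\big)=\min_s\{v(a_s(\theta))+s\,v(\phi_r(\theta))\}$, where $\deg(a_s)<\deg(\phi_r)$. It is known that $\mu_F$ is an inductive valuation depending only on $F$, that $F$ is a key polynomial for $\mu_F$, and that $\mu_F$ has an optimal MacLane chain with key polynomials $\phi_0,\dots,\phi_r$ and slopes $v(\phi_i(\theta))$. *)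

theory Defs
  imports
    "HOL-Algebra.Algebraic_Closure_Type"
    "HOL-Algebra.Generated_Fields"
    "HOL-Library.Poly_Mapping"
    "HOL-Library.Extended"
begin

section \<open>Value groups and valuations\<close>

text \<open>
  Totally ordered \<open>\<rat>\<close>-vector spaces, i.e. divisible totally ordered abelian groups. Compatibility of
  scaling by positive rationals with the order follows from the axioms. The group \<open>\<rat>\<Gamma>\<close> is the
  \<open>\<rat>\<close>-span of \<open>\<Gamma>\<close> in such a group.
\<close>

class linordered_rat_vector = linordered_ab_group_add +
  fixes scaleQ :: "rat \<Rightarrow> 'a \<Rightarrow> 'a" (infixr "*\<^sub>Q" 75)
  assumes scaleQ_add_right: "q *\<^sub>Q (x + y) = q *\<^sub>Q x + q *\<^sub>Q y"
    and scaleQ_add_left: "(p + q) *\<^sub>Q x = p *\<^sub>Q x + q *\<^sub>Q x"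
    and scaleQ_scaleQ: "p *\<^sub>Q q *\<^sub>Q x = (p * q) *\<^sub>Q x"
    and scaleQ_one: "1 *\<^sub>Q x = x"

abbreviation divide_nat :: "'g::linordered_rat_vector \<Rightarrow> nat \<Rightarrow> 'g" (infixl "'/\<^sub>Q" 70)
  where "x /\<^sub>Q n \<equiv> (1 / of_nat n) *\<^sub>Q x"

text \<open>Values lie in \<^typ>\<open>'g extended\<close>; the element \<^const>\<open>Minf\<close> is never attained.\<close>

definition valuation :: "('r::idom \<Rightarrow> 'g::linordered_ab_group_add extended) \<Rightarrow> bool" where
  "valuation w \<longleftrightarrow>
     (\<forall>x. w x \<noteq> Minf) \<and> (\<forall>x. w x = Pinf \<longleftrightarrow> x = 0) \<and>
     (\<forall>x y. w (x * y) = w x + w y) \<and> (\<forall>x y. min (w x) (w y) \<le> w (x + y))"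

text \<open>The value of an element known to have finite valuation.\<close>

fun fin_part :: "'g::zero extended \<Rightarrow> 'g" where
  "fin_part (Fin x) = x"
| "fin_part Pinf = 0"
| "fin_part Minf = 0"

text \<open>Intended for a subfield \<open>E\<close> of the domain of \<open>w\<close>.\<close>

definition value_group :: "('r::zero \<Rightarrow> 'g extended) \<Rightarrow> 'r set \<Rightarrow> 'g set" where
  "value_group w E = {\<gamma>. \<exists>x\<in>E. x \<noteq> 0 \<and> w x = Fin \<gamma>}"

definition rational_hull :: "'g::linordered_rat_vector set \<Rightarrow> 'g set" where
  "rational_hull \<Gamma> = {q. \<exists>n>0. of_nat n *\<^sub>Q q \<in> \<Gamma>}"

definition extends_to_closure ::
    "('a::field \<Rightarrow> 'g::linordered_ab_group_add extended) \<Rightarrow> ('a alg_closure \<Rightarrow> 'g extended) \<Rightarrow> bool" where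
  "extends_to_closure v w \<longleftrightarrow> valuation w \<and> (\<forall>x. w (to_ac x) = v x)"

text \<open>
  Extensions to the algebraic closure have value group \<open>\<rat>\<Gamma>\<close>, so two equivalent
  extensions with values in the fixed group \<^typ>\<open>'g\<close> are equal.
\<close>

definition henselian :: "('a::field \<Rightarrow> 'g::linordered_rat_vector extended) \<Rightarrow> bool" where
  "henselian v \<longleftrightarrow> valuation v \<and> (\<exists>!w. extends_to_closure v w)"

definition closure_valuation ::
    "('a::field \<Rightarrow> 'g::linordered_ab_group_add extended) \<Rightarrow> 'a alg_closure \<Rightarrow> 'g extended" where
  "closure_valuation v = (THE w. extends_to_closure v w)"

abbreviation eval_ac :: "'a::field poly \<Rightarrow> 'a alg_closure \<Rightarrow> 'a alg_closure" where
  "eval_ac g \<theta> \<equiv> poly (map_poly to_ac g) \<theta>"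

abbreviation monic :: "'a::{zero,one} poly \<Rightarrow> bool" where
  "monic g \<equiv> lead_coeff g = 1"


section \<open>Defectless polynomials\<close>

definition base_field :: "'a::field alg_closure set" where
  "base_field = range to_ac"

definition adjoin :: "'a::field alg_closure \<Rightarrow> 'a alg_closure set" where
  "adjoin \<theta> = generate_field ring_of_type_algebra (insert \<theta> base_field)"

definition ramification_index :: "('a::field \<Rightarrow> 'g::linordered_ab_group_add extended) \<Rightarrow> 'a alg_closure set \<Rightarrow> nat" where
  "ramification_index v E =
     (let G = \<lparr>carrier = value_group (closure_valuation v) E, monoid.mult = (+), one = 0\<rparr>
      in card (rcosets\<^bsub>G\<^esub> (value_group v UNIV)))"

definition valuation_ring :: "('a::field \<Rightarrow> 'g::linordered_ab_group_add extended) \<Rightarrow> 'a alg_closure set \<Rightarrow> 'a alg_closure ring" where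
  "valuation_ring v E = ring_of_type_algebra\<lparr>carrier := {x\<in>E. 0 \<le> closure_valuation v x}\<rparr>"

definition maximal_ideal :: "('a::field \<Rightarrow> 'g::linordered_ab_group_add extended) \<Rightarrow> 'a alg_closure set \<Rightarrow> 'a alg_closure set" where
  "maximal_ideal v E = {x\<in>E. 0 < closure_valuation v x}"

definition residue_field :: "('a::field \<Rightarrow> 'g::linordered_ab_group_add extended) \<Rightarrow> 'a alg_closure set \<Rightarrow> 'a alg_closure set ring" where
  "residue_field v E = valuation_ring v E Quot maximal_ideal v E"

text \<open>The image of the residue field of \<open>K\<close> under its canonical embedding in that of \<open>E\<close>.\<close>

definition residue_base :: "('a::field \<Rightarrow> 'g::linordered_ab_group_add extended) \<Rightarrow> 'a alg_closure set \<Rightarrow> 'a alg_closure set set" where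
  "residue_base v E = (\<lambda>c. maximal_ideal v E +>\<^bsub>valuation_ring v E\<^esub> c) ` carrier (valuation_ring v base_field)"

definition residue_degree :: "('a::field \<Rightarrow> 'g::linordered_ab_group_add extended) \<Rightarrow> 'a alg_closure set \<Rightarrow> nat" where
  "residue_degree v E =
     ring.dim (residue_field v E) (residue_base v E) (carrier (residue_field v E))"

definition defectless :: "('a::field \<Rightarrow> 'g::linordered_ab_group_add extended) \<Rightarrow> 'a poly \<Rightarrow> 'a alg_closure \<Rightarrow> bool" where
  "defectless v F \<theta> \<longleftrightarrow>
     degree F = ramification_index v (adjoin \<theta>) * residue_degree v (adjoin \<theta>)"


section \<open>Weight and Okutsu frames\<close>

text \<open>
  Here \<open>\<theta>\<close> is a root of the monic irreducible polynomial \<open>F\<close>. All roots of \<open>F\<close> are conjugate, so by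
  henselianity nothing depends on the choice of \<open>\<theta>\<close>; for the inner members of an Okutsu frame
  any root is allowed.
\<close>

definition normalized_value :: "('a::field \<Rightarrow> 'g::linordered_rat_vector extended) \<Rightarrow> 'a alg_closure \<Rightarrow> 'a poly \<Rightarrow> 'g extended" where
  "normalized_value v \<theta> g = map_extended (\<lambda>x. x /\<^sub>Q degree g) (closure_valuation v (eval_ac g \<theta>))"

definition weight_set :: "('a::field \<Rightarrow> 'g::linordered_rat_vector extended) \<Rightarrow> 'a poly \<Rightarrow> 'a alg_closure \<Rightarrow> 'g extended set" where
  "weight_set v F \<theta> = {normalized_value v \<theta> g | g. monic g \<and> 0 < degree g \<and> degree g < degree F}"

definition has_weight :: "('a::field \<Rightarrow> 'g::linordered_rat_vector extended) \<Rightarrow> 'a poly \<Rightarrow> 'a alg_closure \<Rightarrow> 'g extended \<Rightarrow> bool" where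
  "has_weight v F \<theta> w \<longleftrightarrow> w \<in> weight_set v F \<theta> \<and> (\<forall>u\<in>weight_set v F \<theta>. u \<le> w)"

definition distinguished_pair :: "('a::field \<Rightarrow> 'g::linordered_rat_vector extended) \<Rightarrow> 'a poly \<Rightarrow> 'a poly \<Rightarrow> 'a alg_closure \<Rightarrow> bool" where
  "distinguished_pair v \<phi> F \<theta> \<longleftrightarrow>
     monic F \<and> irreducible F \<and> 1 < degree F \<and> eval_ac F \<theta> = 0 \<and>
     (\<exists>w. has_weight v F \<theta> w \<and>
        monic \<phi> \<and> 0 < degree \<phi> \<and> normalized_value v \<theta> \<phi> = w \<and>
        (\<forall>g. monic g \<and> 0 < degree g \<and> normalized_value v \<theta> g = w \<longrightarrow> degree \<phi> \<le> degree g))"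

definition okutsu_frame :: "('a::field \<Rightarrow> 'g::linordered_rat_vector extended) \<Rightarrow> 'a poly list \<Rightarrow> 'a poly \<Rightarrow> 'a alg_closure \<Rightarrow> bool" where
  "okutsu_frame v \<phi>s F \<theta> \<longleftrightarrow>
     \<phi>s \<noteq> [] \<and> (\<forall>\<phi>\<in>set \<phi>s. monic \<phi> \<and> irreducible \<phi>) \<and> degree (hd \<phi>s) = 1 \<and>
     (\<forall>i. Suc i < length \<phi>s \<longrightarrow> (\<exists>\<theta>'. distinguished_pair v (\<phi>s ! i) (\<phi>s ! Suc i) \<theta>')) \<and>
     distinguished_pair v (last \<phi>s) F \<theta>"


section \<open>Expansions\<close>

definition adic_coeff :: "'a::field poly \<Rightarrow> 'a poly \<Rightarrow> nat \<Rightarrow> 'a poly" where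
  "adic_coeff \<phi> f s = (f div \<phi> ^ s) mod \<phi>"

lemma degree_adic_coeff: "0 < degree \<phi> \<Longrightarrow> degree (adic_coeff \<phi> f s) < degree \<phi>"
  using degree_mod_less[of \<phi> "f div \<phi> ^ s"] by (cases "\<phi> = 0") (auto simp: adic_coeff_def)

lemma adic_expansion:
  assumes "0 < degree \<phi>"
  shows "f = (\<Sum>s\<le>degree f. adic_coeff \<phi> f s * \<phi> ^ s)"
proof -
  have step: "(\<Sum>s<n. adic_coeff \<phi> f s * \<phi> ^ s) + f div \<phi> ^ n * \<phi> ^ n = f" for n
  proof (induction n)
    case (Suc n)
    have "f div \<phi> ^ n = f div \<phi> ^ Suc n * \<phi> + adic_coeff \<phi> f n"
      by (simp only: adic_coeff_def power_Suc2 poly_div_mult_right div_mult_mod_eq)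
    then have "f div \<phi> ^ n * \<phi> ^ n = adic_coeff \<phi> f n * \<phi> ^ n + f div \<phi> ^ Suc n * \<phi> ^ Suc n"
      by (simp only: distrib_right power_Suc mult.assoc add.commute)
    with Suc show ?case by (simp only: sum.lessThan_Suc add.assoc)
  qed simp
  have "degree f < degree (\<phi> ^ Suc (degree f))"
  proof -
    have "\<phi> \<noteq> 0" using assms by auto
    then have "degree (\<phi> ^ Suc (degree f)) = Suc (degree f) * degree \<phi>"
      by (rule degree_power_eq)
    moreover have "Suc (degree f) * 1 \<le> Suc (degree f) * degree \<phi>"
      using assms by (intro mult_le_mono2) simp
    ultimately show ?thesis by simp
  qed
  then have "f div \<phi> ^ Suc (degree f) = 0" by (rule div_poly_less)
  with step[of "Suc (degree f)"] show ?thesis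
    by (simp only: lessThan_Suc_atMost mult_zero_left add_0_right)
qed

text \<open>
  The map \<open>\<Sum> a\<^sub>s \<phi>\<^sup>s \<mapsto> min (\<nu> a\<^sub>s + s \<gamma>)\<close>. Coefficients of index above \<^term>\<open>degree f\<close> vanish.
\<close>

definition adic_min :: "('a::field poly \<Rightarrow> 'g::linordered_rat_vector extended) \<Rightarrow> 'a poly \<Rightarrow> 'g \<Rightarrow> 'a poly \<Rightarrow> 'g extended" where
  "adic_min \<nu> \<phi> \<gamma> f = Min ((\<lambda>s. \<nu> (adic_coeff \<phi> f s) + Fin (of_nat s *\<^sub>Q \<gamma>)) ` {..degree f})"


section \<open>Graded algebra and key polynomials\<close>

text \<open>
  A valuation \<open>\<mu>\<close> on \<open>K(x)\<close> is given by its restriction to \<open>K[x]\<close>; its value group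
  consists of the values of quotients of polynomials.
\<close>

definition poly_value_group :: "('a::field poly \<Rightarrow> 'g::linordered_ab_group_add extended) \<Rightarrow> 'g set" where
  "poly_value_group \<mu> = {\<alpha> - \<beta> | \<alpha> \<beta> f g. f \<noteq> 0 \<and> g \<noteq> 0 \<and> \<mu> f = Fin \<alpha> \<and> \<mu> g = Fin \<beta>}"

definition val_ge :: "('a::field poly \<Rightarrow> 'g::linordered_ab_group_add extended) \<Rightarrow> 'g \<Rightarrow> 'a poly set" where
  "val_ge \<mu> \<alpha> = {g. Fin \<alpha> \<le> \<mu> g}"

definition val_gt :: "('a::field poly \<Rightarrow> 'g::linordered_ab_group_add extended) \<Rightarrow> 'g \<Rightarrow> 'a poly set" where
  "val_gt \<mu> \<alpha> = {g. Fin \<alpha> < \<mu> g}"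

text \<open>
  The direct sum of the quotients \<open>P\<^sub>\<alpha> / P\<^sub>\<alpha>\<^sup>+\<close> is presented as the quotient of
  \<open>\<Oplus>P\<^sub>\<alpha>\<close> by \<open>\<Oplus>P\<^sub>\<alpha>\<^sup>+\<close>. An element of \<open>\<Oplus>P\<^sub>\<alpha>\<close> is a finitely supported family indexed by
  \<open>\<Gamma>\<^sub>\<mu>\<close>; the multiplication of \<^typ>\<open>'g \<Rightarrow>\<^sub>0 'a poly\<close> is convolution, so a product of
  homogeneous elements of degrees \<open>\<alpha>\<close> and \<open>\<beta>\<close> is the product of polynomials in degree \<open>\<alpha> + \<beta>\<close>.
\<close>

definition rees_ring :: "('a::field poly \<Rightarrow> 'g::linordered_ab_group_add extended) \<Rightarrow> ('g \<Rightarrow>\<^sub>0 'a poly) ring" where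
  "rees_ring \<mu> = ring_of_type_algebra\<lparr>carrier :=
     {u. Poly_Mapping.keys u \<subseteq> poly_value_group \<mu> \<and> (\<forall>\<alpha>. Poly_Mapping.lookup u \<alpha> \<in> val_ge \<mu> \<alpha>)}\<rparr>"

definition rees_ideal :: "('a::field poly \<Rightarrow> 'g::linordered_ab_group_add extended) \<Rightarrow> ('g \<Rightarrow>\<^sub>0 'a poly) set" where
  "rees_ideal \<mu> =
     {u \<in> carrier (rees_ring \<mu>). \<forall>\<alpha>. Poly_Mapping.lookup u \<alpha> \<in> val_gt \<mu> \<alpha>}"

definition graded_algebra :: "('a::field poly \<Rightarrow> 'g::linordered_ab_group_add extended) \<Rightarrow> ('g \<Rightarrow>\<^sub>0 'a poly) set ring" where
  "graded_algebra \<mu> = rees_ring \<mu> Quot rees_ideal \<mu>"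

definition initial_form :: "('a::field poly \<Rightarrow> 'g::linordered_ab_group_add extended) \<Rightarrow> 'a poly \<Rightarrow> ('g \<Rightarrow>\<^sub>0 'a poly) set" where
  "initial_form \<mu> g =
     (if g = 0 then \<zero>\<^bsub>graded_algebra \<mu>\<^esub>
      else rees_ideal \<mu> +>\<^bsub>rees_ring \<mu>\<^esub> Poly_Mapping.single (fin_part (\<mu> g)) g)"

text \<open>For a valuation \<open>\<mu>\<close> the graded algebra is a commutative ring.\<close>

context
  fixes \<mu> :: "'a::field poly \<Rightarrow> 'g::linordered_ab_group_add extended"
  assumes \<mu>: "valuation \<mu>"
begin

lemma \<mu>_zero: "\<mu> 0 = Pinf"
  and \<mu>_mult: "\<mu> (f * g) = \<mu> f + \<mu> g"
  and \<mu>_add: "min (\<mu> f) (\<mu> g) \<le> \<mu> (f + g)"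
  using \<mu> by (auto simp: valuation_def)

lemma \<mu>_Fin: "f \<noteq> 0 \<Longrightarrow> \<exists>\<alpha>. \<mu> f = Fin \<alpha>"
  using \<mu> by (cases "\<mu> f") (auto simp: valuation_def)

lemma \<mu>_unit_square: "u * u = 1 \<Longrightarrow> \<mu> u = 0"
proof -
  have one: "\<mu> 1 = 0"
    using \<mu>_mult[of 1 1] \<mu>_Fin[of 1] by (auto simp: zero_extended_def)
  assume u: "u * u = 1"
  then have "u \<noteq> 0" by auto
  then show "\<mu> u = 0"
    using \<mu>_mult[of u u] \<mu>_Fin[of u] u one by (auto simp: zero_extended_def)
qed

lemma \<mu>_one: "\<mu> 1 = 0"
  by (rule \<mu>_unit_square) simp

lemma \<mu>_minus: "\<mu> (- f) = \<mu> f"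
proof -
  have "\<mu> (- 1 * f) = \<mu> f"
    unfolding \<mu>_mult by (subst \<mu>_unit_square) simp_all
  then show ?thesis by simp
qed

lemma val_ge_0: "0 \<in> val_ge \<mu> \<alpha>" and val_gt_0: "0 \<in> val_gt \<mu> \<alpha>"
  by (simp_all add: val_ge_def val_gt_def \<mu>_zero)

lemma val_ge_add: "f \<in> val_ge \<mu> \<alpha> \<Longrightarrow> g \<in> val_ge \<mu> \<alpha> \<Longrightarrow> f + g \<in> val_ge \<mu> \<alpha>"
  and val_gt_add: "f \<in> val_gt \<mu> \<alpha> \<Longrightarrow> g \<in> val_gt \<mu> \<alpha> \<Longrightarrow> f + g \<in> val_gt \<mu> \<alpha>"
  using \<mu>_add[of f g] by (auto simp: val_ge_def val_gt_def min_def split: if_splits)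

lemma val_ge_mult: "f \<in> val_ge \<mu> \<alpha> \<Longrightarrow> g \<in> val_ge \<mu> \<beta> \<Longrightarrow> f * g \<in> val_ge \<mu> (\<alpha> + \<beta>)"
  unfolding val_ge_def by (cases "\<mu> f"; cases "\<mu> g") (auto simp: \<mu>_mult intro: add_mono)

lemma val_gt_mult: "f \<in> val_gt \<mu> \<alpha> \<Longrightarrow> g \<in> val_ge \<mu> \<beta> \<Longrightarrow> f * g \<in> val_gt \<mu> (\<alpha> + \<beta>)"
  unfolding val_ge_def val_gt_def
  by (cases "\<mu> f"; cases "\<mu> g") (auto simp: \<mu>_mult intro: add_less_le_mono)

lemma poly_value_group_add:
  assumes "\<alpha> \<in> poly_value_group \<mu>" "\<beta> \<in> poly_value_group \<mu>"
  shows "\<alpha> + \<beta> \<in> poly_value_group \<mu>"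
proof -
  obtain a b f g a' b' f' g'
    where "\<alpha> = a - b" "f \<noteq> 0" "g \<noteq> 0" "\<mu> f = Fin a" "\<mu> g = Fin b"
      and "\<beta> = a' - b'" "f' \<noteq> 0" "g' \<noteq> 0" "\<mu> f' = Fin a'" "\<mu> g' = Fin b'"
    using assms unfolding poly_value_group_def by blast
  then have "\<alpha> + \<beta> = (a + a') - (b + b')" "f * f' \<noteq> 0" "g * g' \<noteq> 0"
    "\<mu> (f * f') = Fin (a + a')" "\<mu> (g * g') = Fin (b + b')"
    by (auto simp: \<mu>_mult)
  then show ?thesis unfolding poly_value_group_def by blast
qed

lemma zero_in_poly_value_group: "0 \<in> poly_value_group \<mu>"
proof -
  have "0 = (0::'g) - 0" "\<mu> 1 = Fin 0" "(1 :: 'a poly) \<noteq> 0"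
    by (simp_all add: \<mu>_one zero_extended_def)
  then show ?thesis unfolding poly_value_group_def by blast
qed

lemma Sum_any_closed:
  assumes "0 \<in> S" "\<And>f g. f \<in> S \<Longrightarrow> g \<in> S \<Longrightarrow> f + g \<in> S" "\<And>x. h x \<in> S"
  shows "Sum_any h \<in> (S :: 'a poly set)"
proof -
  have "sum h A \<in> S" for A
    by (induction A rule: infinite_finite_induct) (use assms in auto)
  then show ?thesis by (simp add: Sum_any.expand_set)
qed

lemma lookup_mult_mem:
  assumes "\<And>\<alpha>. Poly_Mapping.lookup w \<alpha> \<in> val_ge \<mu> \<alpha>"
  shows "(\<And>\<alpha>. Poly_Mapping.lookup u \<alpha> \<in> val_ge \<mu> \<alpha>) \<Longrightarrow> Poly_Mapping.lookup (u * w) \<kappa> \<in> val_ge \<mu> \<kappa>"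
    and "(\<And>\<alpha>. Poly_Mapping.lookup u \<alpha> \<in> val_gt \<mu> \<alpha>) \<Longrightarrow> Poly_Mapping.lookup (u * w) \<kappa> \<in> val_gt \<mu> \<kappa>"
proof -
  have inner: "(\<Sum>q. Poly_Mapping.lookup w q when \<kappa> = l + q) \<in> val_ge \<mu> (\<kappa> - l)" for l
    by (rule Sum_any_closed) (auto simp: val_ge_0 val_ge_add when_def assms)
  show "Poly_Mapping.lookup (u * w) \<kappa> \<in> val_ge \<mu> \<kappa>"
    if "\<And>\<alpha>. Poly_Mapping.lookup u \<alpha> \<in> val_ge \<mu> \<alpha>"
    unfolding lookup_mult
    using val_ge_mult[OF that inner, of l l for l]
    by (intro Sum_any_closed) (simp_all add: val_ge_0 val_ge_add)
  show "Poly_Mapping.lookup (u * w) \<kappa> \<in> val_gt \<mu> \<kappa>"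
    if "\<And>\<alpha>. Poly_Mapping.lookup u \<alpha> \<in> val_gt \<mu> \<alpha>"
    unfolding lookup_mult
    using val_gt_mult[OF that inner, of l l for l]
    by (intro Sum_any_closed) (simp_all add: val_gt_0 val_gt_add)
qed

lemma cring_rees_ring: "cring (rees_ring \<mu>)"
proof -
  let ?R = "ring_of_type_algebra :: ('g \<Rightarrow>\<^sub>0 'a poly) ring"
  interpret R: cring ?R by (rule cring_from_type_algebra)
  have minus: "\<ominus>\<^bsub>?R\<^esub> u = - u" for u
    by (rule R.minus_equality) (auto simp: ring_of_type_algebra_def)
  have "subring (carrier (rees_ring \<mu>)) ?R"
  proof (rule R.subringI)
    show "\<one>\<^bsub>?R\<^esub> \<in> carrier (rees_ring \<mu>)"
      using zero_in_poly_value_group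
      by (auto simp: rees_ring_def ring_of_type_algebra_def lookup_one when_def val_ge_0
          in_keys_iff split: if_splits) (simp add: val_ge_def \<mu>_one zero_extended_def)
  next
    fix u w assume "u \<in> carrier (rees_ring \<mu>)" "w \<in> carrier (rees_ring \<mu>)"
    then have keys: "Poly_Mapping.keys u \<subseteq> poly_value_group \<mu>" "Poly_Mapping.keys w \<subseteq> poly_value_group \<mu>"
      and mem: "Poly_Mapping.lookup u \<alpha> \<in> val_ge \<mu> \<alpha>" "Poly_Mapping.lookup w \<alpha> \<in> val_ge \<mu> \<alpha>" for \<alpha>
      by (simp_all add: rees_ring_def)
    have "Poly_Mapping.keys (u * w) \<subseteq> poly_value_group \<mu>"
    proof
      fix x assume "x \<in> Poly_Mapping.keys (u * w)"
      then obtain a b where "x = a + b" "a \<in> Poly_Mapping.keys u" "b \<in> Poly_Mapping.keys w"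
        using subsetD[OF keys_mult] by blast
      then show "x \<in> poly_value_group \<mu>"
        using poly_value_group_add keys by blast
    qed
    moreover have "Poly_Mapping.lookup (u * w) \<alpha> \<in> val_ge \<mu> \<alpha>" for \<alpha>
      by (rule lookup_mult_mem(1)[OF mem(2) mem(1)])
    ultimately show "u \<otimes>\<^bsub>?R\<^esub> w \<in> carrier (rees_ring \<mu>)"
      by (simp add: rees_ring_def ring_of_type_algebra_def)
  next
    fix u w assume "u \<in> carrier (rees_ring \<mu>)" "w \<in> carrier (rees_ring \<mu>)"
    then show "u \<oplus>\<^bsub>?R\<^esub> w \<in> carrier (rees_ring \<mu>)"
      using Poly_Mapping.keys_add[of u w]
      by (auto simp: rees_ring_def ring_of_type_algebra_def lookup_add intro: val_ge_add)
  next
    fix u assume "u \<in> carrier (rees_ring \<mu>)"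
    then show "\<ominus>\<^bsub>?R\<^esub> u \<in> carrier (rees_ring \<mu>)"
      unfolding minus by (simp add: rees_ring_def val_ge_def \<mu>_minus)
  qed (simp add: ring_of_type_algebra_def)
  then have "cring (?R\<lparr>carrier := carrier (rees_ring \<mu>)\<rparr>)"
    using R.subcringI' R.subcring_iff subringE(1) by blast
  then show ?thesis by (simp add: rees_ring_def)
qed

lemma ideal_rees_ideal: "ideal (rees_ideal \<mu>) (rees_ring \<mu>)"
proof -
  interpret cring "rees_ring \<mu>" by (rule cring_rees_ring)
  have sub: "rees_ideal \<mu> \<subseteq> carrier (rees_ring \<mu>)" by (auto simp: rees_ideal_def)
  have zero: "0 \<in> rees_ideal \<mu>"
    by (auto simp: rees_ideal_def rees_ring_def val_ge_0 val_gt_0)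
  have add: "u + w \<in> rees_ideal \<mu>" if "u \<in> rees_ideal \<mu>" "w \<in> rees_ideal \<mu>" for u w
    using that a_closed[of u w]
    by (auto simp: rees_ideal_def rees_ring_def ring_of_type_algebra_def lookup_add intro: val_gt_add)
  have minus: "- u \<in> rees_ideal \<mu>" if "u \<in> rees_ideal \<mu>" for u
    using that by (auto simp: rees_ideal_def rees_ring_def val_ge_def val_gt_def \<mu>_minus)
  have inv: "inv\<^bsub>add_monoid (rees_ring \<mu>)\<^esub> u = - u" if "u \<in> rees_ideal \<mu>" for u
    unfolding a_inv_def[symmetric] using subsetD[OF sub that] subsetD[OF sub minus[OF that]]
    by (intro minus_equality) (auto simp: rees_ring_def ring_of_type_algebra_def)
  have mult: "u * w \<in> rees_ideal \<mu>" if "u \<in> rees_ideal \<mu>" "w \<in> carrier (rees_ring \<mu>)" for u w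
  proof -
    have "u * w \<in> carrier (rees_ring \<mu>)"
      using m_closed[OF subsetD[OF sub that(1)] that(2)]
      by (simp add: rees_ring_def ring_of_type_algebra_def)
    moreover have "Poly_Mapping.lookup (u * w) \<kappa> \<in> val_gt \<mu> \<kappa>" for \<kappa>
      using that by (intro lookup_mult_mem(2)) (simp_all add: rees_ideal_def rees_ring_def)
    ultimately show ?thesis by (simp add: rees_ideal_def)
  qed
  show ?thesis
  proof (rule idealI[OF ring_axioms])
    show "subgroup (rees_ideal \<mu>) (add_monoid (rees_ring \<mu>))"
    proof
      fix u assume u: "u \<in> rees_ideal \<mu>"
      show "inv\<^bsub>add_monoid (rees_ring \<mu>)\<^esub> u \<in> rees_ideal \<mu>"
        unfolding inv[OF u] by (rule minus[OF u])
    next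
      show "rees_ideal \<mu> \<subseteq> carrier (add_monoid (rees_ring \<mu>))"
        using sub by simp
    next
      show "\<one>\<^bsub>add_monoid (rees_ring \<mu>)\<^esub> \<in> rees_ideal \<mu>"
        using zero by (simp add: rees_ring_def ring_of_type_algebra_def)
    next
      fix u w assume "u \<in> rees_ideal \<mu>" "w \<in> rees_ideal \<mu>"
      then have "u + w \<in> rees_ideal \<mu>" by (rule add)
      then show "u \<otimes>\<^bsub>add_monoid (rees_ring \<mu>)\<^esub> w \<in> rees_ideal \<mu>"
        by (simp add: rees_ring_def ring_of_type_algebra_def)
    qed
  next
    fix u w assume uw: "u \<in> rees_ideal \<mu>" "w \<in> carrier (rees_ring \<mu>)"
    have "u \<otimes>\<^bsub>rees_ring \<mu>\<^esub> w = u * w" "w \<otimes>\<^bsub>rees_ring \<mu>\<^esub> u = w * u"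
      by (simp_all add: rees_ring_def ring_of_type_algebra_def)
    then show "w \<otimes>\<^bsub>rees_ring \<mu>\<^esub> u \<in> rees_ideal \<mu>" "u \<otimes>\<^bsub>rees_ring \<mu>\<^esub> w \<in> rees_ideal \<mu>"
      using mult[OF uw] by (simp_all only: mult.commute[of w u])
  qed
qed

lemma cring_graded_algebra: "cring (graded_algebra \<mu>)"
  unfolding graded_algebra_def
  by (rule ideal.quotient_is_cring[OF ideal_rees_ideal cring_rees_ring])

end

definition key_polynomial :: "('a::field \<Rightarrow> 'g::linordered_ab_group_add extended) \<Rightarrow> ('a poly \<Rightarrow> 'g extended) \<Rightarrow> 'a poly \<Rightarrow> bool" where
  "key_polynomial v \<mu> \<phi> \<longleftrightarrow>
     valuation \<mu> \<and> (\<forall>c. \<mu> [:c:] = v c) \<and> monic \<phi> \<and>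
     ring_prime\<^bsub>graded_algebra \<mu>\<^esub> (initial_form \<mu> \<phi>) \<and>
     (\<forall>f. f \<noteq> 0 \<and> degree f < degree \<phi> \<longrightarrow>
        \<not> initial_form \<mu> \<phi> divides\<^bsub>graded_algebra \<mu>\<^esub> initial_form \<mu> f)"


section \<open>MacLane chains\<close>

primrec maclane_valuation :: "('a::field \<Rightarrow> 'g::linordered_rat_vector extended) \<Rightarrow> (nat \<Rightarrow> 'a poly) \<Rightarrow> (nat \<Rightarrow> 'g) \<Rightarrow> nat \<Rightarrow> 'a poly \<Rightarrow> 'g extended" where
  "maclane_valuation v \<phi> \<gamma> 0 = adic_min (\<lambda>a. v (coeff a 0)) (\<phi> 0) (\<gamma> 0)"
| "maclane_valuation v \<phi> \<gamma> (Suc i) = adic_min (maclane_valuation v \<phi> \<gamma> i) (\<phi> (Suc i)) (\<gamma> (Suc i))"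

text \<open>Only the entries of \<open>\<phi>\<close> and \<open>\<gamma>\<close> of index at most \<open>r\<close> are relevant.\<close>

definition maclane_chain :: "('a::field \<Rightarrow> 'g::linordered_rat_vector extended) \<Rightarrow> nat \<Rightarrow> (nat \<Rightarrow> 'a poly) \<Rightarrow> (nat \<Rightarrow> 'g) \<Rightarrow> bool" where
  "maclane_chain v r \<phi> \<gamma> \<longleftrightarrow>
     monic (\<phi> 0) \<and> degree (\<phi> 0) = 1 \<and>
     (\<forall>i\<le>r. \<gamma> i \<in> rational_hull (value_group v UNIV)) \<and>
     (\<forall>i<r. key_polynomial v (maclane_valuation v \<phi> \<gamma> i) (\<phi> (Suc i)) \<and>
            maclane_valuation v \<phi> \<gamma> i (\<phi> (Suc i)) < Fin (\<gamma> (Suc i)))"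

definition optimal_maclane_chain :: "('a::field \<Rightarrow> 'g::linordered_rat_vector extended) \<Rightarrow> ('a poly \<Rightarrow> 'g extended) \<Rightarrow> nat \<Rightarrow> (nat \<Rightarrow> 'a poly) \<Rightarrow> (nat \<Rightarrow> 'g) \<Rightarrow> bool" where
  "optimal_maclane_chain v \<mu> r \<phi> \<gamma> \<longleftrightarrow>
     maclane_chain v r \<phi> \<gamma> \<and> \<mu> = maclane_valuation v \<phi> \<gamma> r \<and>
     (\<forall>i<r. degree (\<phi> i) dvd degree (\<phi> (Suc i)) \<and> degree (\<phi> i) < degree (\<phi> (Suc i)))"

fun secondary_slope :: "('a::field \<Rightarrow> 'g::linordered_rat_vector extended) \<Rightarrow> (nat \<Rightarrow> 'a poly) \<Rightarrow> (nat \<Rightarrow> 'g) \<Rightarrow> nat \<Rightarrow> 'g" where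
  "secondary_slope v \<phi> \<gamma> 0 = \<gamma> 0"
| "secondary_slope v \<phi> \<gamma> (Suc i) =
     fin_part (maclane_valuation v \<phi> \<gamma> (Suc i) (\<phi> (Suc i))) -
     fin_part (maclane_valuation v \<phi> \<gamma> i (\<phi> (Suc i)))"

text \<open>The valuation attached to a defectless polynomial with root \<open>\<theta>\<close> and Okutsu frame \<open>\<phi>s\<close>.\<close>

definition attached_valuation :: "('a::field \<Rightarrow> 'g::linordered_rat_vector extended) \<Rightarrow> 'a poly list \<Rightarrow> 'a alg_closure \<Rightarrow> 'a poly \<Rightarrow> 'g extended" where
  "attached_valuation v \<phi>s \<theta> =
     adic_min (\<lambda>a. closure_valuation v (eval_ac a \<theta>)) (last \<phi>s)
       (fin_part (closure_valuation v (eval_ac (last \<phi>s) \<theta>)))"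

end

theory Submission
  imports Defs
begin

text \<open>
  If \<open>\<mu>\<close> is given by minima over \<open>\<phi>\<close>-expansions with slope \<open>\<gamma>\<close>, and monic polynomials of degree less
  than \<open>deg \<phi>\<close> have value at most \<open>\<gamma> / deg \<phi>\<close> per degree, then looking at the leading term of the
  expansion shows that the same bound holds for all monic polynomials, with equality at \<open>\<phi>\<close>. Hence
  \<open>\<gamma> / deg \<phi>\<close> is the maximum of \<open>\<mu>(f) / deg f\<close> and depends only on \<open>\<mu>\<close>. This applies to
  the presentation of \<open>\<mu>\<^sub>F\<close> coming from the Okutsu frame, where the maximum is \<open>w(F)\<close>, and to each step
  of a MacLane chain, where it is \<open>\<gamma>\<^sub>i / m\<^sub>i\<close>.
  A key polynomial \<open>\<chi>\<close> cannot have smaller value than another monic polynomial of its degree, so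
  comparison with a power of \<open>\<phi>\<^sub>i\<close> gives \<open>\<mu>\<^sub>i(\<phi>\<^sub>i\<^sub>+\<^sub>1) / m\<^sub>i\<^sub>+\<^sub>1 = \<gamma>\<^sub>i / m\<^sub>i\<close>, and the sum of
  the \<open>\<lambda>\<^sub>i / m\<^sub>i\<close> telescopes.
\<close>

section \<open>Rational scaling\<close>

lemma scaleQ_zero_right [simp]: "q *\<^sub>Q (0 :: 'g::linordered_rat_vector) = 0"
  using scaleQ_add_right[of q "0::'g" 0] by simp

lemma scaleQ_zero_left [simp]: "0 *\<^sub>Q (x :: 'g::linordered_rat_vector) = 0"
  using scaleQ_add_left[of 0 0 x] by simp

lemma scaleQ_minus_right: "q *\<^sub>Q (- x :: 'g::linordered_rat_vector) = - (q *\<^sub>Q x)"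
  using scaleQ_add_right[of q x "- x"] by (simp add: add_eq_0_iff)

lemma scaleQ_diff_right: "q *\<^sub>Q (x - y :: 'g::linordered_rat_vector) = q *\<^sub>Q x - q *\<^sub>Q y"
  using scaleQ_add_right[of q x "- y"] by (simp add: scaleQ_minus_right)

text \<open>The axioms of \<open>linordered_rat_vector\<close> do not mention the order of scaled
  elements. For natural factors monotonicity comes from repeated addition, and dividing by a
  positive n reduces to this case by multiplying back.\<close>

lemma of_nat_scaleQ_nonneg: "0 \<le> x \<Longrightarrow> 0 \<le> of_nat n *\<^sub>Q (x :: 'g::linordered_rat_vector)"
  by (induction n) (auto simp: scaleQ_add_left scaleQ_one)

lemma of_nat_scaleQ_pos:
  assumes "0 < x" "0 < n"
  shows "0 < of_nat n *\<^sub>Q (x :: 'g::linordered_rat_vector)"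
  using assms of_nat_scaleQ_nonneg[of x "n - 1"]
  by (cases n) (auto simp: scaleQ_add_left scaleQ_one add_pos_nonneg)

lemma of_nat_scaleQ_mono: "x \<le> y \<Longrightarrow> of_nat n *\<^sub>Q x \<le> of_nat n *\<^sub>Q (y :: 'g::linordered_rat_vector)"
  using of_nat_scaleQ_nonneg[of "y - x" n] by (simp add: scaleQ_diff_right)

lemma of_nat_scaleQ_le_cancel:
  assumes "0 < n" "of_nat n *\<^sub>Q x \<le> of_nat n *\<^sub>Q (y :: 'g::linordered_rat_vector)"
  shows "x \<le> y"
proof (rule ccontr)
  assume "\<not> x \<le> y"
  then have "0 < of_nat n *\<^sub>Q (x - y)"
    using assms by (intro of_nat_scaleQ_pos) auto
  with assms show False by (simp add: scaleQ_diff_right)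
qed

lemma of_nat_scaleQ_divide_nat [simp]: "0 < n \<Longrightarrow> of_nat n *\<^sub>Q (x /\<^sub>Q n) = (x :: 'g::linordered_rat_vector)"
  by (simp add: scaleQ_scaleQ scaleQ_one)

lemma le_divide_natI:
  assumes "0 < n" "of_nat n *\<^sub>Q y \<le> x"
  shows "y \<le> x /\<^sub>Q n"
proof (rule of_nat_scaleQ_le_cancel)
  show "of_nat n *\<^sub>Q y \<le> of_nat n *\<^sub>Q (x /\<^sub>Q n)"
    using assms by (simp only: of_nat_scaleQ_divide_nat)
qed fact

lemma divide_nat_leI:
  assumes "0 < n" "x \<le> of_nat n *\<^sub>Q y"
  shows "x /\<^sub>Q n \<le> y"
proof (rule of_nat_scaleQ_le_cancel)
  show "of_nat n *\<^sub>Q (x /\<^sub>Q n) \<le> of_nat n *\<^sub>Q y"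
    using assms by (simp only: of_nat_scaleQ_divide_nat)
qed fact

lemma of_nat_mult_scaleQ_divide_nat:
  "0 < n \<Longrightarrow> of_nat (k * n) *\<^sub>Q (x /\<^sub>Q n) = of_nat k *\<^sub>Q (x :: 'g::linordered_rat_vector)"
  by (simp add: scaleQ_scaleQ)

lemma divide_nat_unique: "0 < n \<Longrightarrow> of_nat n *\<^sub>Q y = x \<Longrightarrow> y = x /\<^sub>Q n"
  for x y :: "'g::linordered_rat_vector"
  by (auto simp: scaleQ_scaleQ scaleQ_one)


section \<open>Valuations given by expansions\<close>

text \<open>The remainder of f modulo \<open>\<phi> ^ k\<close> has degree below k
  deg(\<open>\<phi>\<close>) \<le> deg(f), so the quotient inherits the leading term of f. By the
  choice of k the quotient has degree below deg(\<open>\<phi>\<close>), hence it is already the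
  coefficient of index k.\<close>

lemma adic_coeff_lead:
  fixes f \<phi> :: "'a::field poly"
  assumes "monic \<phi>" "0 < degree \<phi>" "monic f"
  defines "k \<equiv> degree f div degree \<phi>"
  shows "monic (adic_coeff \<phi> f k)" "degree (adic_coeff \<phi> f k) + k * degree \<phi> = degree f"
proof -
  define q where "q = f div \<phi> ^ k"
  have nz: "\<phi> \<noteq> 0" using assms by auto
  have dk: "degree (\<phi> ^ k) = k * degree \<phi>"
    using nz by (rule degree_power_eq)
  have lk: "lead_coeff (\<phi> ^ k) = 1"
    using assms by (simp add: lead_coeff_power)
  have dec: "f = q * \<phi> ^ k + f mod \<phi> ^ k"
    unfolding q_def by (rule div_mult_mod_eq[symmetric])
  have q: "monic q \<and> degree q + k * degree \<phi> = degree f"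
  \<comment> \<open>For k = 0 the divisor is the constant 1, and the strict degree bound on the
    remainder fails.\<close>
  proof (cases "k = 0")
    case True
    then show ?thesis using assms by (simp add: q_def)
  next
    case False
    have "degree (f mod \<phi> ^ k) < degree (\<phi> ^ k)"
      using degree_mod_less[of "\<phi> ^ k" f] nz False assms(2) dk by auto
    moreover have "q \<noteq> 0"
    proof
      assume "q = 0"
      then have "degree f < k * degree \<phi>"
        using dec dk calculation by simp
      then show False
        using div_times_less_eq_dividend[of "degree f" "degree \<phi>"] by (simp add: k_def)
    qed
    then have "degree (q * \<phi> ^ k) = degree q + k * degree \<phi>"
      using nz by (simp add: degree_mult_eq dk)
    ultimately have "degree (f mod \<phi> ^ k) < degree (q * \<phi> ^ k)" by (simp add: dk)
    then have "degree f = degree (q * \<phi> ^ k)" "lead_coeff f = lead_coeff (q * \<phi> ^ k)"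
      using degree_add_eq_left[of "f mod \<phi> ^ k" "q * \<phi> ^ k"]
        lead_coeff_add_le[of "f mod \<phi> ^ k" "q * \<phi> ^ k"] dec
      by (simp_all add: add.commute)
    then show ?thesis
      using \<open>degree (q * \<phi> ^ k) = _\<close> assms(3) lead_coeff_mult[of q "\<phi> ^ k"] lk by simp
  qed
  moreover have "degree q < degree \<phi>"
    using q assms(2) mod_less_divisor[of "degree \<phi>" "degree f"] div_mult_mod_eq[of "degree f" "degree \<phi>"]
    unfolding k_def by linarith
  then have "adic_coeff \<phi> f k = q"
    by (simp add: adic_coeff_def q_def mod_poly_less)
  ultimately show "monic (adic_coeff \<phi> f k)" "degree (adic_coeff \<phi> f k) + k * degree \<phi> = degree f"
    by simp_all
qed

text \<open>The minimum is at most its term of top index k, whose coefficient a is monic; deg(a) + k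
  deg(\<open>\<phi>\<close>) = deg(f) makes the two contributions add up exactly.
  \<open>\<nu>\<close> is an arbitrary function, so that it may also be evaluation at
  \<open>\<theta>\<close>, which gives F the value \<open>Pinf\<close>.\<close>

lemma adic_min_le_monic:
  fixes f \<phi> :: "'a::field poly" and \<gamma> :: "'g::linordered_rat_vector"
  assumes \<phi>: "monic \<phi>" "0 < degree \<phi>" and f: "monic f"
    and bound: "\<And>a. monic a \<Longrightarrow> degree a < degree \<phi> \<Longrightarrow> \<nu> a \<le> Fin (of_nat (degree a) *\<^sub>Q (\<gamma> /\<^sub>Q degree \<phi>))"
  shows "adic_min \<nu> \<phi> \<gamma> f \<le> Fin (of_nat (degree f) *\<^sub>Q (\<gamma> /\<^sub>Q degree \<phi>))"
proof -
  define k where "k = degree f div degree \<phi>"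
  define a where "a = adic_coeff \<phi> f k"
  note lead = adic_coeff_lead[OF \<phi> f, folded k_def a_def]
  have "adic_min \<nu> \<phi> \<gamma> f \<le> \<nu> a + Fin (of_nat k *\<^sub>Q \<gamma>)"
    unfolding adic_min_def a_def by (rule Min_le) (auto simp: k_def intro: imageI)
  also have "\<dots> \<le> Fin (of_nat (degree a) *\<^sub>Q (\<gamma> /\<^sub>Q degree \<phi>)) + Fin (of_nat k *\<^sub>Q \<gamma>)"
    using lead(1) degree_adic_coeff[OF \<phi>(2), of f k] by (intro add_right_mono bound) (simp_all add: a_def)
  also have "\<dots> = Fin (of_nat (degree a + k * degree \<phi>) *\<^sub>Q (\<gamma> /\<^sub>Q degree \<phi>))"
    unfolding of_nat_add scaleQ_add_left using of_nat_mult_scaleQ_divide_nat[OF \<phi>(2), of k \<gamma>] by simp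
  finally show ?thesis unfolding lead(2) .
qed

lemma adic_min_self:
  assumes "0 < degree \<phi>" "\<nu> 0 = Pinf" "\<nu> 1 = 0"
  shows "adic_min \<nu> \<phi> \<gamma> \<phi> = Fin \<gamma>"
proof -
  have nz: "\<phi> \<noteq> 0" using assms by auto
  have c: "adic_coeff \<phi> \<phi> s = (if s = 1 then 1 else 0)" for s
  proof -
    consider "s = 0" | "s = 1" | "2 \<le> s" by linarith
    then show ?thesis
    proof cases
      case 2
      have "1 mod \<phi> = 1" using assms by (simp add: mod_poly_less)
      with 2 show ?thesis using nz by (simp add: adic_coeff_def)
    next
      case 3
      then have "1 * degree \<phi> < s * degree \<phi>" using assms(1) by (intro mult_strict_right_mono) auto
      then have "\<phi> div \<phi> ^ s = 0"
        using nz by (intro div_poly_less) (simp add: degree_power_eq)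
      with 3 show ?thesis by (simp add: adic_coeff_def)
    qed (simp add: adic_coeff_def)
  qed
  have "(\<lambda>s. \<nu> (adic_coeff \<phi> \<phi> s) + Fin (of_nat s *\<^sub>Q \<gamma>)) s = (if s = 1 then Fin \<gamma> else Pinf)" for s
    using assms by (simp add: c zero_extended_def scaleQ_one)
  \<comment> \<open>Index 1 lies in \<open>{..degree \<phi>}\<close> because \<open>\<phi>\<close>
    is not constant; all other terms are \<open>Pinf\<close>.\<close>
  then show ?thesis
    unfolding adic_min_def using assms(1) by (intro Min_eqI) (auto simp: image_iff intro!: bexI[of _ 1])
qed

lemma valuation_one:
  assumes "valuation w"
  shows "w 1 = 0"
proof -
  obtain a where a: "w 1 = Fin a" using assms by (cases "w 1") (auto simp: valuation_def)
  have "w (1 * 1) = w 1 + w 1" using assms unfolding valuation_def by blast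
  then show ?thesis by (simp add: a zero_extended_def)
qed

lemma valuation_power:
  assumes "valuation \<mu>" "\<mu> f = Fin (\<alpha> :: 'g::linordered_rat_vector)"
  shows "\<mu> (f ^ n) = Fin (of_nat n *\<^sub>Q \<alpha>)"
proof (induction n)
  case 0
  then show ?case using valuation_one[OF assms(1)] by (simp add: zero_extended_def)
next
  case (Suc n)
  then show ?case
    using assms by (simp add: valuation_def scaleQ_add_left scaleQ_one)
qed


section \<open>Key polynomials\<close>

text \<open>The difference g - f has larger value than f, so f and g have the same value
  \<open>\<alpha>\<close>, and their homogeneous elements of degree \<open>\<alpha>\<close> differ
  by an element of \<open>rees_ideal \<mu>\<close>.\<close>

lemma initial_form_eqI:
  fixes \<mu> :: "'a::field poly \<Rightarrow> 'g::linordered_ab_group_add extended"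
  assumes \<mu>: "valuation \<mu>" and "f \<noteq> 0" "\<mu> f < \<mu> (g - f)"
  shows "initial_form \<mu> g = initial_form \<mu> f" "initial_form \<mu> f \<in> carrier (graded_algebra \<mu>)"
    "g \<noteq> 0"
proof -
  obtain \<alpha> where \<alpha>: "\<mu> f = Fin \<alpha>" using \<mu>_Fin[OF \<mu> \<open>f \<noteq> 0\<close>] by blast
  show "g \<noteq> 0" using assms \<mu>_minus[OF \<mu>, of f] by auto
  have ge: "Fin \<alpha> \<le> \<mu> g"
    using \<mu>_add[OF \<mu>, of f "g - f"] assms(3) \<alpha> by (simp add: min_def split: if_splits)
  moreover have "\<mu> g \<le> Fin \<alpha>"
    using \<mu>_add[OF \<mu>, of g "- (g - f)"] assms(3) \<alpha> by (simp only: \<mu>_minus[OF \<mu>]) (auto simp: min_def split: if_splits)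
  ultimately have g: "\<mu> g = Fin \<alpha>" by simp
  \<comment> \<open>\<open>\<alpha>\<close> is the value of the quotient f / 1.\<close>
  have "\<alpha> = \<alpha> - 0" "\<mu> 1 = Fin 0" "(1 :: 'a poly) \<noteq> 0"
    using \<mu>_one[OF \<mu>] by (simp_all add: zero_extended_def)
  then have vg: "\<alpha> \<in> poly_value_group \<mu>"
    unfolding poly_value_group_def using \<alpha> \<open>f \<noteq> 0\<close> by blast
  interpret cring "rees_ring \<mu>" by (rule cring_rees_ring[OF \<mu>])
  interpret ideal "rees_ideal \<mu>" "rees_ring \<mu>" by (rule ideal_rees_ideal[OF \<mu>])
  have sf: "Poly_Mapping.single \<alpha> f \<in> carrier (rees_ring \<mu>)"
    using vg \<alpha> \<mu>_zero[OF \<mu>]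
    by (auto simp: rees_ring_def val_ge_def lookup_single when_def split: if_splits)
  have sd: "Poly_Mapping.single \<alpha> (g - f) \<in> rees_ideal \<mu>"
    using vg \<alpha> \<mu>_zero[OF \<mu>] assms(3)
    by (auto simp: rees_ideal_def rees_ring_def val_ge_def val_gt_def lookup_single when_def
        split: if_splits)
  have "Poly_Mapping.single \<alpha> g = Poly_Mapping.single \<alpha> (g - f) \<oplus>\<^bsub>rees_ring \<mu>\<^esub> Poly_Mapping.single \<alpha> f"
    by (simp add: rees_ring_def ring_of_type_algebra_def flip: single_add)
  then have "Poly_Mapping.single \<alpha> g \<in> rees_ideal \<mu> +>\<^bsub>rees_ring \<mu>\<^esub> Poly_Mapping.single \<alpha> f"
    using sd by (auto simp: a_r_coset_def')
  then have "rees_ideal \<mu> +>\<^bsub>rees_ring \<mu>\<^esub> Poly_Mapping.single \<alpha> f =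
      rees_ideal \<mu> +>\<^bsub>rees_ring \<mu>\<^esub> Poly_Mapping.single \<alpha> g"
    using sf a_subgroup by (intro a_repr_independence)
  then show "initial_form \<mu> g = initial_form \<mu> f"
    using \<open>f \<noteq> 0\<close> \<open>g \<noteq> 0\<close> by (simp add: initial_form_def g \<alpha>)
  show "initial_form \<mu> f \<in> carrier (graded_algebra \<mu>)"
    using \<open>f \<noteq> 0\<close> sf by (auto simp: initial_form_def \<alpha> graded_algebra_def FactRing_def intro: a_rcosetsI)
qed

text \<open>If g had larger value, then \<open>\<chi> - g\<close>, of smaller degree than
  \<open>\<chi>\<close>, would have the same initial form as \<open>\<chi>\<close>. Reflexivity of
  divisibility then contradicts the minimality in \<open>key_polynomial\<close>.\<close>

lemma key_polynomial_maximal: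
  fixes \<mu> :: "'a::field poly \<Rightarrow> 'g::linordered_ab_group_add extended"
  assumes key: "key_polynomial v \<mu> \<chi>" and g: "monic g" "degree g = degree \<chi>" "0 < degree \<chi>"
  shows "\<mu> g \<le> \<mu> \<chi>"
proof (rule ccontr)
  assume "\<not> \<mu> g \<le> \<mu> \<chi>"
  then have less: "\<mu> \<chi> < \<mu> g" by simp
  have \<mu>: "valuation \<mu>" and \<chi>: "monic \<chi>"
    and ndvd: "\<And>f. f \<noteq> 0 \<Longrightarrow> degree f < degree \<chi> \<Longrightarrow>
      \<not> initial_form \<mu> \<chi> divides\<^bsub>graded_algebra \<mu>\<^esub> initial_form \<mu> f"
    using key by (auto simp: key_polynomial_def)
  interpret G: cring "graded_algebra \<mu>" by (rule cring_graded_algebra[OF \<mu>])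
  have "degree (\<chi> - g) < degree \<chi>"
  proof (rule degree_lessI)
    show "\<chi> - g \<noteq> 0 \<or> 0 < degree \<chi>" using g by simp
    show "\<forall>k\<ge>degree \<chi>. coeff (\<chi> - g) k = 0"
      using g \<chi> by (auto simp: coeff_eq_0 le_less)
  qed
  moreover have "\<mu> \<chi> < \<mu> ((\<chi> - g) - \<chi>)"
    using less \<mu>_minus[OF \<mu>, of g] by simp
  moreover have "\<chi> \<noteq> 0" using \<chi> by auto
  ultimately show False
    using ndvd[of "\<chi> - g"] initial_form_eqI[OF \<mu>, of \<chi> "\<chi> - g"] G.divides_refl by metis
qed


section \<open>MacLane chains\<close>

text \<open>The valuation is instantiated with the last member of the chain, so the equation inside
  \<open>optimal_maclane_chain\<close> is trivial and only conditions on \<open>\<phi>\<close> and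
  \<open>\<gamma>\<close> remain.\<close>

locale optimal_chain =
  fixes v :: "'a::field \<Rightarrow> 'g::linordered_rat_vector extended" and r :: nat
    and \<phi> :: "nat \<Rightarrow> 'a poly" and \<gamma> :: "nat \<Rightarrow> 'g"
  assumes v: "valuation v"
    and optimal: "optimal_maclane_chain v (maclane_valuation v \<phi> \<gamma> r) r \<phi> \<gamma>"
begin

lemma chain: "maclane_chain v r \<phi> \<gamma>"
  and dvd: "i < r \<Longrightarrow> degree (\<phi> i) dvd degree (\<phi> (Suc i))"
  and less: "i < r \<Longrightarrow> degree (\<phi> i) < degree (\<phi> (Suc i))"
  using optimal by (auto simp: optimal_maclane_chain_def)

lemma chain_monic: "i \<le> r \<Longrightarrow> monic (\<phi> i)"
  using chain by (cases i) (auto simp: maclane_chain_def key_polynomial_def)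

lemma chain_degree_pos: "i \<le> r \<Longrightarrow> 0 < degree (\<phi> i)"
  using chain less[of "i - 1"] by (cases i) (auto simp: maclane_chain_def)

lemma chain_key: "i < r \<Longrightarrow> key_polynomial v (maclane_valuation v \<phi> \<gamma> i) (\<phi> (Suc i))"
  using chain by (simp add: maclane_chain_def)

text \<open>Being a valuation is part of \<open>key_polynomial\<close>, which is given only for i <
  r. Values at index r are therefore computed from \<open>adic_min\<close> over the preceding
  member.\<close>

lemma chain_valuation: "i < r \<Longrightarrow> valuation (maclane_valuation v \<phi> \<gamma> i)"
  using chain_key by (simp add: key_polynomial_def)

lemma maclane_valuation_slope: "i \<le> r \<Longrightarrow> maclane_valuation v \<phi> \<gamma> i (\<phi> i) = Fin (\<gamma> i)"
proof (cases i)
  case 0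
  have "v 0 = Pinf" using v by (simp add: valuation_def)
  then show ?thesis
    using 0 chain_degree_pos[of 0] by (simp add: adic_min_self valuation_one[OF v])
next
  case (Suc j)
  moreover assume "i \<le> r"
  ultimately show ?thesis
    using chain_degree_pos[of i] chain_valuation[of j]
    by (simp add: adic_min_self \<mu>_zero \<mu>_one)
qed

text \<open>The two claims feed each other: the bound at i determines the value of the next key
  polynomial, and since \<open>\<gamma> (Suc i)\<close> exceeds that value, the bound passes on to i
  + 1.\<close>

lemma maclane_valuation_le_monic:
  "i \<le> r \<Longrightarrow> monic f \<Longrightarrow>
    maclane_valuation v \<phi> \<gamma> i f \<le> Fin (of_nat (degree f) *\<^sub>Q (\<gamma> i /\<^sub>Q degree (\<phi> i)))"
  and maclane_valuation_next_key:
  "i < r \<Longrightarrow> maclane_valuation v \<phi> \<gamma> i (\<phi> (Suc i)) =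
    Fin (of_nat (degree (\<phi> (Suc i))) *\<^sub>Q (\<gamma> i /\<^sub>Q degree (\<phi> i)))"
proof -
  \<comment> \<open>The bound at i is a hypothesis here, so that this fact can be used inside the
    induction below.\<close>
  have next_key: "maclane_valuation v \<phi> \<gamma> i (\<phi> (Suc i)) =
      Fin (of_nat (degree (\<phi> (Suc i))) *\<^sub>Q (\<gamma> i /\<^sub>Q degree (\<phi> i)))"
    if i: "i < r" and bound: "\<And>f. monic f \<Longrightarrow>
      maclane_valuation v \<phi> \<gamma> i f \<le> Fin (of_nat (degree f) *\<^sub>Q (\<gamma> i /\<^sub>Q degree (\<phi> i)))" for i
  proof (rule antisym)
    obtain k where k: "degree (\<phi> (Suc i)) = k * degree (\<phi> i)"
      using dvd[OF i] by (auto simp: dvd_def mult.commute)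
    have \<phi>i: "monic (\<phi> i)" "0 < degree (\<phi> i)" "0 < degree (\<phi> (Suc i))"
      using chain_monic[of i] chain_degree_pos[of i] chain_degree_pos[of "Suc i"] i by auto
    then have "\<phi> i \<noteq> 0" by auto
    \<comment> \<open>Divisibility of the degrees makes a power of \<open>\<phi> i\<close> a monic
      competitor of the same degree as the key polynomial.\<close>
    have "maclane_valuation v \<phi> \<gamma> i (\<phi> i ^ k) \<le> maclane_valuation v \<phi> \<gamma> i (\<phi> (Suc i))"
    proof (rule key_polynomial_maximal[OF chain_key[OF i]])
      show "monic (\<phi> i ^ k)" unfolding lead_coeff_power using \<phi>i(1) by simp
      show "degree (\<phi> i ^ k) = degree (\<phi> (Suc i))"
        using \<open>\<phi> i \<noteq> 0\<close> k by (simp add: degree_power_eq)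
    qed fact
    then show "Fin (of_nat (degree (\<phi> (Suc i))) *\<^sub>Q (\<gamma> i /\<^sub>Q degree (\<phi> i))) \<le>
        maclane_valuation v \<phi> \<gamma> i (\<phi> (Suc i))"
      using valuation_power[OF chain_valuation[OF i] maclane_valuation_slope, of k] i \<phi>i
      unfolding k by (simp add: of_nat_mult_scaleQ_divide_nat del: of_nat_mult)
    show "maclane_valuation v \<phi> \<gamma> i (\<phi> (Suc i)) \<le>
        Fin (of_nat (degree (\<phi> (Suc i))) *\<^sub>Q (\<gamma> i /\<^sub>Q degree (\<phi> i)))"
      using bound chain_monic[of "Suc i"] i by simp
  qed
  have bound: "i \<le> r \<Longrightarrow> monic f \<Longrightarrow>
    maclane_valuation v \<phi> \<gamma> i f \<le> Fin (of_nat (degree f) *\<^sub>Q (\<gamma> i /\<^sub>Q degree (\<phi> i)))" for i f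
  proof (induction i arbitrary: f)
    case 0
    \<comment> \<open>A monic polynomial of degree below 1 is the constant 1, of value 0.\<close>
    have "v (coeff a 0) \<le> Fin (of_nat (degree a) *\<^sub>Q (\<gamma> 0 /\<^sub>Q degree (\<phi> 0)))"
      if "monic a" "degree a < degree (\<phi> 0)" for a
      using that chain valuation_one[OF v] by (simp add: maclane_chain_def zero_extended_def)
    then show ?case
      using 0 chain_monic[of 0] chain_degree_pos[of 0] by (simp add: adic_min_le_monic)
  next
    case (Suc i)
    then have i: "i < r" by simp
    have "of_nat (degree (\<phi> (Suc i))) *\<^sub>Q (\<gamma> i /\<^sub>Q degree (\<phi> i)) \<le> \<gamma> (Suc i)"
      using next_key[OF i Suc.IH] i chain by (auto simp: maclane_chain_def)
    \<comment> \<open>Slopes per degree do not decrease along the chain, so the bound at i implies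
      the hypothesis of \<open>adic_min_le_monic\<close> for the new slope.\<close>
    then have slope: "\<gamma> i /\<^sub>Q degree (\<phi> i) \<le> \<gamma> (Suc i) /\<^sub>Q degree (\<phi> (Suc i))"
      using chain_degree_pos[of "Suc i"] Suc.prems by (auto intro: le_divide_natI)
    have "maclane_valuation v \<phi> \<gamma> i a \<le>
        Fin (of_nat (degree a) *\<^sub>Q (\<gamma> (Suc i) /\<^sub>Q degree (\<phi> (Suc i))))" if "monic a" for a
      using Suc.IH[OF _ that] i of_nat_scaleQ_mono[OF slope, of "degree a"]
      by (meson less_eq_extended.simps(1) less_or_eq_imp_le order_trans)
    then show ?case
      using Suc.prems chain_monic[of "Suc i"] chain_degree_pos[of "Suc i"]
      by (simp add: adic_min_le_monic)
  qed
  show "i \<le> r \<Longrightarrow> monic f \<Longrightarrow>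
    maclane_valuation v \<phi> \<gamma> i f \<le> Fin (of_nat (degree f) *\<^sub>Q (\<gamma> i /\<^sub>Q degree (\<phi> i)))"
    by (rule bound)
  show "i < r \<Longrightarrow> maclane_valuation v \<phi> \<gamma> i (\<phi> (Suc i)) =
    Fin (of_nat (degree (\<phi> (Suc i))) *\<^sub>Q (\<gamma> i /\<^sub>Q degree (\<phi> i)))"
    by (rule next_key) (simp_all add: bound)
qed

text \<open>By \<open>maclane_valuation_next_key\<close>, each secondary slope over its degree is
  the difference of two consecutive slopes over their degrees.\<close>

lemma slope_eq_sum_secondary_slopes:
  "i \<le> r \<Longrightarrow> \<gamma> i /\<^sub>Q degree (\<phi> i) = (\<Sum>j\<le>i. secondary_slope v \<phi> \<gamma> j /\<^sub>Q degree (\<phi> j))"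
proof (induction i)
  case (Suc i)
  let ?m = "degree (\<phi> (Suc i))"
  have "secondary_slope v \<phi> \<gamma> (Suc i) = \<gamma> (Suc i) - of_nat ?m *\<^sub>Q (\<gamma> i /\<^sub>Q degree (\<phi> i))"
    using maclane_valuation_slope[OF Suc.prems] maclane_valuation_next_key[of i] Suc.prems
    by (simp del: maclane_valuation.simps)
  moreover have "(of_nat ?m *\<^sub>Q (\<gamma> i /\<^sub>Q degree (\<phi> i))) /\<^sub>Q ?m = \<gamma> i /\<^sub>Q degree (\<phi> i)"
    using chain_degree_pos[OF Suc.prems] by (intro divide_nat_unique[symmetric]) simp_all
  ultimately show ?case
    using Suc by (simp add: scaleQ_diff_right del: secondary_slope.simps)
qed simp

end


section \<open>Weights\<close>

lemma eval_ac_add: "eval_ac (p + q) \<theta> = eval_ac p \<theta> + eval_ac q \<theta>"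
  by (induction p q rule: poly_induct2) (simp_all add: map_poly_pCons algebra_simps)

lemma eval_ac_mult: "eval_ac (p * q) \<theta> = eval_ac p \<theta> * eval_ac q \<theta>"
proof -
  have smult: "eval_ac (smult a q) \<theta> = to_ac a * eval_ac q \<theta>" for a
    by (induction q) (simp_all add: map_poly_pCons algebra_simps)
  show ?thesis
    by (induction p) (simp_all add: map_poly_pCons eval_ac_add smult algebra_simps)
qed

lemma degree_le_of_common_root:
  fixes F g :: "'a::field poly"
  assumes "irreducible F" "eval_ac F \<theta> = 0" "eval_ac g \<theta> = 0" "g \<noteq> 0"
  shows "degree F \<le> degree g"
proof -
  \<comment> \<open>h is a minimal polynomial of \<open>\<theta>\<close> up to a scalar: it divides
    F and is not constant, so irreducibility makes it an associate of F.\<close>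
  define h where "h = (ARG_MIN degree p. p \<noteq> 0 \<and> eval_ac p \<theta> = 0)"
  have h: "h \<noteq> 0" "eval_ac h \<theta> = 0"
    using arg_min_natI[of "\<lambda>p. p \<noteq> 0 \<and> eval_ac p \<theta> = 0" g degree] assms
    unfolding h_def by auto
  have min: "degree h \<le> degree p" if "p \<noteq> 0" "eval_ac p \<theta> = 0" for p
    using arg_min_nat_le[of "\<lambda>p. p \<noteq> 0 \<and> eval_ac p \<theta> = 0" p degree] that
    unfolding h_def by auto
  have "eval_ac (F mod h) \<theta> = 0"
    using eval_ac_add[of "F div h * h" "F mod h" \<theta>] eval_ac_mult[of "F div h" h \<theta>] assms h
    by simp
  then have "F mod h = 0"
    using min[of "F mod h"] degree_mod_less[OF h(1), of F] by (cases "F mod h = 0") auto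
  then have F: "F = h * (F div h)" by (metis mod_0_imp_dvd dvd_mult_div_cancel)
  moreover have "\<not> h dvd 1"
    using h by (auto simp: is_unit_poly_iff map_poly_pCons)
  ultimately have "F div h dvd 1" using irreducibleD[OF assms(1) F] by blast
  then have "degree (F div h) = 0" by (auto simp: is_unit_poly_iff)
  then have "degree F \<le> degree h" using degree_mult_le[of h "F div h"] F by simp
  also have "\<dots> \<le> degree g" using min assms by blast
  finally show ?thesis .
qed

section \<open>Weights and the attached valuation\<close>

lemma valuation_closure_valuation:
  assumes "henselian v"
  shows "valuation (closure_valuation v)"
proof -
  have "extends_to_closure v (closure_valuation v)"
    unfolding closure_valuation_def
    by (rule theI'[of "extends_to_closure v"]) (use assms in \<open>simp add: henselian_def\<close>)
  then show ?thesis by (simp add: extends_to_closure_def)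
qed

text \<open>The weight is attained by some g of degree below deg(F), so minimality of
  \<open>\<psi>\<close> forces deg(\<open>\<psi>\<close>) < deg(F). Hence \<open>\<psi>\<close> does
  not vanish at \<open>\<theta>\<close>, and \<open>\<delta>\<close> is its true value rather than
  the default of \<open>fin_part\<close>.\<close>

lemma distinguished_pair_weight:
  fixes v :: "'a::field \<Rightarrow> 'g::linordered_rat_vector extended"
  assumes "henselian v" and pair: "distinguished_pair v \<psi> F \<theta>"
  defines "\<delta> \<equiv> fin_part (closure_valuation v (eval_ac \<psi> \<theta>))"
  shows "has_weight v F \<theta> (Fin (\<delta> /\<^sub>Q degree \<psi>))" "monic \<psi>" "0 < degree \<psi>" "degree \<psi> < degree F"
proof -
  obtain w where w: "has_weight v F \<theta> w" and \<psi>: "monic \<psi>" "0 < degree \<psi>" "normalized_value v \<theta> \<psi> = w"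
    and min: "\<And>g. monic g \<Longrightarrow> 0 < degree g \<Longrightarrow> normalized_value v \<theta> g = w \<Longrightarrow> degree \<psi> \<le> degree g"
    and F: "irreducible F" "eval_ac F \<theta> = 0"
    using pair unfolding distinguished_pair_def by blast
  obtain g where "monic g" "0 < degree g" "degree g < degree F" "normalized_value v \<theta> g = w"
    using w by (auto simp: has_weight_def weight_set_def)
  then show deg: "degree \<psi> < degree F" using min by fastforce
  show "monic \<psi>" "0 < degree \<psi>" by fact+
  have "eval_ac \<psi> \<theta> \<noteq> 0"
    using degree_le_of_common_root[OF F, of \<psi>] deg \<psi> by (cases "\<psi> = 0") auto
  then have "closure_valuation v (eval_ac \<psi> \<theta>) = Fin \<delta>"
    using valuation_closure_valuation[OF assms(1)]
    by (cases "closure_valuation v (eval_ac \<psi> \<theta>)") (auto simp: valuation_def \<delta>_def)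
  then show "has_weight v F \<theta> (Fin (\<delta> /\<^sub>Q degree \<psi>))"
    using w \<psi> by (simp add: normalized_value_def)
qed

lemma value_le_of_has_weight:
  fixes v :: "'a::field \<Rightarrow> 'g::linordered_rat_vector extended"
  assumes v: "henselian v" and w: "has_weight v F \<theta> (Fin \<delta>)"
    and a: "monic a" "degree a < degree F"
  shows "closure_valuation v (eval_ac a \<theta>) \<le> Fin (of_nat (degree a) *\<^sub>Q \<delta>)"
\<comment> \<open>\<open>weight_set\<close> covers positive degrees only; the remaining monic
  polynomial is 1.\<close>
proof (cases "degree a = 0")
  case True
  then have "a = 1" using a by (metis degree_0_id one_pCons)
  then show ?thesis
    using valuation_one[OF valuation_closure_valuation[OF v]] by (simp add: zero_extended_def)
next
  case False
  then have "normalized_value v \<theta> a \<le> Fin \<delta>"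
    using w a by (auto simp: has_weight_def weight_set_def)
  then show ?thesis
    using False of_nat_scaleQ_mono[of _ \<delta> "degree a"] of_nat_scaleQ_divide_nat[of "degree a"]
    by (cases "closure_valuation v (eval_ac a \<theta>)") (fastforce simp: normalized_value_def)+
qed

text \<open>The monic polynomials to be bounded have degree below that of the last frame member,
  hence below deg(F), and so obey the weight bound at \<open>\<theta>\<close>.\<close>

lemma attached_valuation_le_monic:
  fixes v :: "'a::field \<Rightarrow> 'g::linordered_rat_vector extended"
  assumes v: "henselian v" and pair: "distinguished_pair v (last \<phi>s) F \<theta>" and "monic f"
  defines "\<delta> \<equiv> fin_part (closure_valuation v (eval_ac (last \<phi>s) \<theta>))"
  shows "attached_valuation v \<phi>s \<theta> f \<le> Fin (of_nat (degree f) *\<^sub>Q (\<delta> /\<^sub>Q degree (last \<phi>s)))"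
  unfolding attached_valuation_def \<delta>_def
  using distinguished_pair_weight[OF v pair] assms(3)
  by (intro adic_min_le_monic value_le_of_has_weight[OF v, of F]) auto

lemma attached_valuation_last:
  fixes v :: "'a::field \<Rightarrow> 'g::linordered_rat_vector extended"
  assumes v: "henselian v" and pair: "distinguished_pair v (last \<phi>s) F \<theta>"
  shows "attached_valuation v \<phi>s \<theta> (last \<phi>s) = Fin (fin_part (closure_valuation v (eval_ac (last \<phi>s) \<theta>)))"
  unfolding attached_valuation_def
  using valuation_closure_valuation[OF v]
  by (intro adic_min_self distinguished_pair_weight(3)[OF v pair])
    (simp_all add: valuation_one, simp add: valuation_def)

theorem corollary1p7:
  fixes v :: "'a::field \<Rightarrow> 'g::linordered_rat_vector extended"
    and F :: "'a poly" and \<theta> :: "'a alg_closure" and \<phi>s :: "'a poly list" and r :: nat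
    and \<mu>\<^sub>F :: "'a poly \<Rightarrow> 'g extended" and \<phi> :: "nat \<Rightarrow> 'a poly" and \<gamma> lam :: "nat \<Rightarrow> 'g"
    and m :: "nat \<Rightarrow> nat"
  assumes "henselian v"
    and "monic F" and "irreducible F" and "degree F > 1" and "eval_ac F \<theta> = 0"
    and "defectless v F \<theta>"
    and "okutsu_frame v \<phi>s F \<theta>" and "length \<phi>s = Suc r"
    and "\<mu>\<^sub>F = attached_valuation v \<phi>s \<theta>"
    and "optimal_maclane_chain v \<mu>\<^sub>F r \<phi> \<gamma>"
    and "\<And>i. m i = degree (\<phi> i)" and "\<And>i. lam i = secondary_slope v \<phi> \<gamma> i"
  shows "has_weight v F \<theta> (Fin (\<gamma> r /\<^sub>Q m r)) \<and>
         \<gamma> r /\<^sub>Q m r = (\<Sum>i\<le>r. lam i /\<^sub>Q m i)"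
proof
  have \<mu>: "\<mu>\<^sub>F = maclane_valuation v \<phi> \<gamma> r"
    using \<open>optimal_maclane_chain v \<mu>\<^sub>F r \<phi> \<gamma>\<close> by (simp add: optimal_maclane_chain_def)
  interpret optimal_chain v r \<phi> \<gamma>
    using \<open>henselian v\<close> \<open>optimal_maclane_chain v \<mu>\<^sub>F r \<phi> \<gamma>\<close> unfolding \<mu>
    by unfold_locales (simp add: henselian_def)
  show "\<gamma> r /\<^sub>Q m r = (\<Sum>i\<le>r. lam i /\<^sub>Q m i)"
    using slope_eq_sum_secondary_slopes[of r] by (simp add: assms(11,12))
  have pair: "distinguished_pair v (last \<phi>s) F \<theta>"
    using \<open>okutsu_frame v \<phi>s F \<theta>\<close> by (simp add: okutsu_frame_def)
  define \<psi> where "\<psi> = last \<phi>s"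
  define \<delta> where "\<delta> = fin_part (closure_valuation v (eval_ac \<psi> \<theta>))"
  note weight = distinguished_pair_weight[OF \<open>henselian v\<close> pair, folded \<psi>_def, folded \<delta>_def]
  have \<phi>r: "monic (\<phi> r)" "0 < degree (\<phi> r)"
    using chain_monic[of r] chain_degree_pos[of r] by simp_all
  \<comment> \<open>Evaluate \<open>\<mu>\<^sub>F\<close> at \<open>\<phi> r\<close>: its value is
    \<open>\<gamma> r\<close> by the chain, and the presentation at \<open>\<theta>\<close> bounds
    it by the weight.\<close>
  have "Fin (\<gamma> r) \<le> Fin (of_nat (degree (\<phi> r)) *\<^sub>Q (\<delta> /\<^sub>Q degree \<psi>))"
    using attached_valuation_le_monic[OF \<open>henselian v\<close> pair \<phi>r(1)] maclane_valuation_slope[of r]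
    by (simp add: \<psi>_def \<delta>_def \<open>\<mu>\<^sub>F = attached_valuation v \<phi>s \<theta>\<close>[symmetric] \<mu>)
  then have "\<gamma> r /\<^sub>Q degree (\<phi> r) \<le> \<delta> /\<^sub>Q degree \<psi>"
    using \<phi>r(2) by (intro divide_nat_leI) simp_all
  \<comment> \<open>Conversely, \<open>\<psi>\<close> has value \<open>\<delta>\<close> by the
    presentation at \<open>\<theta>\<close>, and the chain bounds it.\<close>
  moreover have "Fin \<delta> \<le> Fin (of_nat (degree \<psi>) *\<^sub>Q (\<gamma> r /\<^sub>Q degree (\<phi> r)))"
    using attached_valuation_last[OF \<open>henselian v\<close> pair] maclane_valuation_le_monic[OF order_refl weight(2)]
    by (simp add: \<psi>_def \<delta>_def \<open>\<mu>\<^sub>F = attached_valuation v \<phi>s \<theta>\<close>[symmetric] \<mu>)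
  then have "\<delta> /\<^sub>Q degree \<psi> \<le> \<gamma> r /\<^sub>Q degree (\<phi> r)"
    using weight(3) by (intro divide_nat_leI) simp_all
  ultimately show "has_weight v F \<theta> (Fin (\<gamma> r /\<^sub>Q m r))"
    using weight(1) by (simp add: assms(11))
qed

end
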